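(* Let $S=\langle d_0,d_1,d_2,d_3\rangle$ be a numerical semigroup with embedding dimension four. Form the collection $R$ from the initial collection of cubes by deleting: (i) the region associated to every point $(a_{01},a_{02},a_{03})\in\mathbb N^3$ with $a_{00}d_0=a_{01}d_1+a_{02}d_2+a_{03}d_3$; (ii) the regions associated to the points $(b_{11},-b_{12},-b_{13})$, $(-b_{21},b_{22},-b_{23})$, $(-b_{31},-b_{32},b_{33})$ coming from the $d_0$-positive minimal relations; (iii) for every identity $\lambda_0d_0+\lambda_1d_1=\lambda_2d_2+\lambda_3d_3$ with $\lambda_i\in\mathbb N$, $\lambda_0>0$, $\lambda_2<b_{22}$, $\lambda_3<b_{33}$, the region associated to $(-\lambda_1,\lambda_2,\lambda_3)$; for every identity $\lambda_0d_0+\lambda_2d_2=\lambda_1d_1+\lambda_3d_3$ with $\lambda_i\in\mathbb N$, $\lambda_0>0$, $\lambda_1<b_{11}$, $\lambda_3<b_{33}$, the region associated to $(\lambda_1,-\lambda_2,\lambda_3)$; and for every identity $\lambda_0d_0+\lambda_3d_3=\lambda_1d_1+\lambda_2d_2$ with $\lambda_i\in\mathbb N$, $\lambda_0>0$, $\lambda_1<b_{11}$, $\lambda_2<b_{22}$, the region associated to $(\lambda_1,\lambda_2,-\lambda_3)$. Then $R$ is exactly the set of cubes of the initial collection whose labels belong to $\mathrm{Ap}(S,d_0)$.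
   Context: $S=\langle d_0,d_1,d_2,d_3\rangle$ is the set of nonnegative integer combinations of positive integers $d_0,\dots,d_3$ with $\gcd=1$, which are its minimal generators. $\mathrm{Ap}(S,d_0)=\{s\in S: s-d_0\notin S\}$. For $(i,j,k)\in\mathbb N^3$ the cube $[[i,j,k]]=[i,i+1]\times[j,j+1]\times[k,k+1]$ is labeled with $id_1+jd_2+kd_3$; the initial collection of cubes consists of all these labeled cubes. For $P=(a,b,c)\in\mathbb Z^3$ the region associated to $P$ is $\{x>a,y>b,z>c\}$; deleting it removes every cube $[[i,j,k]]$ with $i\ge a$, $j\ge b$, $k\ge c$. The integer $a_{00}$ is the least positive integer such that $a_{00}d_0=a_{01}d_1+a_{02}d_2+a_{03}d_3$ for some $a_{0j}\in\mathbb N$. For $i\in\{1,2,3\}$, $b_{ii}$ is the least positive integer such that $b_{ii}d_i=\sum_{j\ne i}b_{ij}d_j$ for some $b_{ij}\in\mathbb N$ with $b_{i0}>0$ (the $d_0$-positive minimal relations); the $b_{ij}$, $j\ne i$, are fixed coefficients realizing these relations. *)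

theory Defs
  imports Complex_Main
begin

definition nonneg_combs :: "nat set \<Rightarrow> nat set" where
  "nonneg_combs A = {(\<Sum>x\<in>A. c x * x) | c. True}"

definition minimal_generators :: "nat set \<Rightarrow> nat set \<Rightarrow> bool" where
  "minimal_generators A S \<longleftrightarrow>
     S = nonneg_combs A \<and> (\<forall>B. B \<subset> A \<longrightarrow> nonneg_combs B \<noteq> S)"

(* The subtraction takes place in the integers: s belongs to the Apery set in particular
   when s < n. *)
definition Apery :: "nat set \<Rightarrow> nat \<Rightarrow> nat set" where
  "Apery S n = {s \<in> S. int s - int n \<notin> int ` S}"

definition cube :: "nat \<Rightarrow> nat \<Rightarrow> nat \<Rightarrow> (real \<times> real \<times> real) set" where
  "cube i j k = {real i..real i + 1} \<times> {real j..real j + 1} \<times> {real k..real k + 1}"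

(* A labeled cube is the pair of the cube and its label. *)
type_synonym labeled_cube = "(real \<times> real \<times> real) set \<times> nat"

definition initial_cubes :: "(nat \<Rightarrow> nat) \<Rightarrow> labeled_cube set" where
  "initial_cubes d = {(cube i j k, i * d 1 + j * d 2 + k * d 3) | i j k. True}"

definition region :: "int \<times> int \<times> int \<Rightarrow> (real \<times> real \<times> real) set" where
  "region P = (case P of (a, b, c) \<Rightarrow>
     {(x, y, z). x > real_of_int a \<and> y > real_of_int b \<and> z > real_of_int c})"

(* The labeled cubes removed when the region associated to P is deleted; by
   cube_meets_region_iff below these are the cubes that meet the region. *)
definition removed :: "int \<times> int \<times> int \<Rightarrow> labeled_cube set" where
  "removed P = (case P of (a, b, c) \<Rightarrow>
     {(cube i j k, s) | i j k s. int i \<ge> a \<and> int j \<ge> b \<and> int k \<ge> c})"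

definition delete_regions ::
    "(int \<times> int \<times> int) set \<Rightarrow> labeled_cube set \<Rightarrow> labeled_cube set" where
  "delete_regions X C = C - (\<Union>P\<in>X. removed P)"

definition a00 :: "(nat \<Rightarrow> nat) \<Rightarrow> nat" where
  "a00 d = (LEAST n. n > 0 \<and> (\<exists>a1 a2 a3. n * d 0 = a1 * d 1 + a2 * d 2 + a3 * d 3))"

definition d0_positive_relation :: "(nat \<Rightarrow> nat) \<Rightarrow> nat \<Rightarrow> nat \<Rightarrow> (nat \<Rightarrow> nat) \<Rightarrow> bool" where
  "d0_positive_relation d i n c \<longleftrightarrow>
     n > 0 \<and> c 0 > 0 \<and> n * d i = (\<Sum>j\<in>{0..3} - {i}. c j * d j)"

(* b i i is the least coefficient and (b i j), j \<noteq> i, are some coefficients realizing it.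
   The coefficients need not be unique; b fixes a choice. *)
definition d0_positive_minimal_relations :: "(nat \<Rightarrow> nat) \<Rightarrow> (nat \<Rightarrow> nat \<Rightarrow> nat) \<Rightarrow> bool" where
  "d0_positive_minimal_relations d b \<longleftrightarrow>
     (\<forall>i\<in>{1..3}. b i i = (LEAST n. \<exists>c. d0_positive_relation d i n c) \<and>
                 d0_positive_relation d i (b i i) (b i))"

definition points_a :: "(nat \<Rightarrow> nat) \<Rightarrow> (int \<times> int \<times> int) set" where
  "points_a d = {(int a1, int a2, int a3) | a1 a2 a3.
     a00 d * d 0 = a1 * d 1 + a2 * d 2 + a3 * d 3}"

definition points_b :: "(nat \<Rightarrow> nat \<Rightarrow> nat) \<Rightarrow> (int \<times> int \<times> int) set" where
  "points_b b =
     {(int (b 1 1), - int (b 1 2), - int (b 1 3)),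
      (- int (b 2 1), int (b 2 2), - int (b 2 3)),
      (- int (b 3 1), - int (b 3 2), int (b 3 3))}"

definition points_mixed ::
    "(nat \<Rightarrow> nat) \<Rightarrow> (nat \<Rightarrow> nat \<Rightarrow> nat) \<Rightarrow> (int \<times> int \<times> int) set" where
  "points_mixed d b =
     {(- int l1, int l2, int l3) | l0 l1 l2 l3.
        l0 * d 0 + l1 * d 1 = l2 * d 2 + l3 * d 3 \<and> l0 > 0 \<and> l2 < b 2 2 \<and> l3 < b 3 3} \<union>
     {(int l1, - int l2, int l3) | l0 l1 l2 l3.
        l0 * d 0 + l2 * d 2 = l1 * d 1 + l3 * d 3 \<and> l0 > 0 \<and> l1 < b 1 1 \<and> l3 < b 3 3} \<union>
     {(int l1, int l2, - int l3) | l0 l1 l2 l3.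
        l0 * d 0 + l3 * d 3 = l1 * d 1 + l2 * d 2 \<and> l0 > 0 \<and> l1 < b 1 1 \<and> l2 < b 2 2}"

lemma cube_meets_region_iff:
  "cube i j k \<inter> region (a, b, c) \<noteq> {} \<longleftrightarrow> int i \<ge> a \<and> int j \<ge> b \<and> int k \<ge> c"
proof
  assume "cube i j k \<inter> region (a, b, c) \<noteq> {}"
  then have "real_of_int a < real i + 1" "real_of_int b < real j + 1" "real_of_int c < real k + 1"
    by (auto simp: cube_def region_def)
  then show "int i \<ge> a \<and> int j \<ge> b \<and> int k \<ge> c"
    by linarith
next
  assume h: "int i \<ge> a \<and> int j \<ge> b \<and> int k \<ge> c"
  have "(real i + 1, real j + 1, real k + 1) \<in> cube i j k \<inter> region (a, b, c)"
    using h by (auto simp: cube_def region_def)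
  then show "cube i j k \<inter> region (a, b, c) \<noteq> {}"
    by blast
qed

lemma cube_inject: "cube i j k = cube i' j' k' \<longleftrightarrow> i = i' \<and> j = j' \<and> k = k'"
  by (auto simp: cube_def times_eq_iff)

(* The minima defining a00 and b i i exist. *)
lemma a00_exists:
  assumes "d 1 > 0"
  shows "\<exists>n::nat. n > 0 \<and> (\<exists>a1 a2 a3. n * d 0 = a1 * d 1 + a2 * d 2 + a3 * (d 3 :: nat))"
  using assms by (intro exI[of _ "d 1"] conjI exI[of _ "d 0"] exI[of _ 0]) auto

lemma d0_positive_relation_exists:
  assumes "d 0 > 0" "d i > 0" "i \<in> {1..3}"
  shows "\<exists>n c. d0_positive_relation d i n c"
proof -
  have "(\<Sum>j\<in>{0..3} - {i}. (if j = 0 then d i else 0) * d j) = d i * d 0"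
    using assms by (simp add: if_distrib[of "\<lambda>x. x * _"] sum.delta cong: if_cong)
  then have "d0_positive_relation d i (d 0) (\<lambda>j. if j = 0 then d i else 0)"
    using assms by (simp add: d0_positive_relation_def)
  then show ?thesis by blast
qed

end

theory Submission
  imports Defs
begin

text \<open>
  A label \<open>i d\<^sub>1 + j d\<^sub>2 + k d\<^sub>3\<close> lies outside the Apery set iff some integer point
  \<open>p \<le> (i, j, k)\<close> satisfies \<open>p\<^sub>1 d\<^sub>1 + p\<^sub>2 d\<^sub>2 + p\<^sub>3 d\<^sub>3 = l d\<^sub>0\<close> with \<open>l > 0\<close>, and every deleted
  region belongs to such a point. Conversely, given \<open>p\<close>: if exactly one coordinate is positive,
  minimality puts it above \<open>b\<^sub>i\<^sub>i\<close>; if exactly two are, either one of them reaches its \<open>b\<^sub>i\<^sub>i\<close>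
  or \<open>p\<close> is itself a point of type (iii). If all three are positive, subtract a point
  \<open>a\<close> with \<open>a\<^sub>1 d\<^sub>1 + a\<^sub>2 d\<^sub>2 + a\<^sub>3 d\<^sub>3 = a\<^sub>0\<^sub>0 d\<^sub>0\<close>: either \<open>p \<ge> a\<close>, or \<open>p - a\<close> is covered by the
  previous cases.
\<close>

section \<open>Representations by the generators\<close>

lemma nonneg_combs_generators:
  fixes d :: "nat \<Rightarrow> nat"
  assumes "inj_on d {0..3}"
  shows "s \<in> nonneg_combs (d ` {0..3}) \<longleftrightarrow>
    (\<exists>m0 m1 m2 m3. s = m0 * d 0 + m1 * d 1 + m2 * d 2 + m3 * d 3)"
proof -
  have ivl: "{0..3::nat} = {0, 1, 2, 3}" by auto
  have sum: "(\<Sum>x\<in>d ` {0..3}. c x * x) =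
      c (d 0) * d 0 + c (d 1) * d 1 + c (d 2) * d 2 + c (d 3) * d 3" for c
    using sum.reindex[OF assms, of "\<lambda>x. c x * x"] by (simp add: ivl)
  show ?thesis
  proof
    assume "s \<in> nonneg_combs (d ` {0..3})"
    then show "\<exists>m0 m1 m2 m3. s = m0 * d 0 + m1 * d 1 + m2 * d 2 + m3 * d 3"
      unfolding nonneg_combs_def sum by blast
  next
    assume "\<exists>m0 m1 m2 m3. s = m0 * d 0 + m1 * d 1 + m2 * d 2 + m3 * d 3"
    then obtain m0 m1 m2 m3 where s: "s = m0 * d 0 + m1 * d 1 + m2 * d 2 + m3 * d 3"
      by blast
    \<comment> \<open>\<open>nonneg_combs\<close> indexes coefficients by the values of the
      generators, so the four given coefficients are carried along the inverse of
      \<open>d\<close>.\<close>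
    define c where "c x = [m0, m1, m2, m3] ! (the_inv_into {0..3} d x)" for x
    have "c (d i) = [m0, m1, m2, m3] ! i" if "i \<in> {0..3}" for i
      using that by (simp add: c_def the_inv_into_f_f[OF assms])
    then have "s = c (d 0) * d 0 + c (d 1) * d 1 + c (d 2) * d 2 + c (d 3) * d 3"
      by (simp add: s)
    then show "s \<in> nonneg_combs (d ` {0..3})"
      unfolding nonneg_combs_def sum by blast
  qed
qed

lemma d0_positive_relation_simps:
  "d0_positive_relation d 1 n c \<longleftrightarrow>
    n > 0 \<and> c 0 > 0 \<and> n * d 1 = c 0 * d 0 + c 2 * d 2 + c 3 * d 3"
  "d0_positive_relation d 2 n c \<longleftrightarrow>
    n > 0 \<and> c 0 > 0 \<and> n * d 2 = c 0 * d 0 + c 1 * d 1 + c 3 * d 3"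
  "d0_positive_relation d 3 n c \<longleftrightarrow>
    n > 0 \<and> c 0 > 0 \<and> n * d 3 = c 0 * d 0 + c 1 * d 1 + c 2 * d 2"
proof -
  have ivl: "{0..3} - {1} = {0, 2, 3::nat}" "{0..3} - {2} = {0, 1, 3::nat}"
    "{0..3} - {3} = {0, 1, 2::nat}" by auto
  show "d0_positive_relation d 1 n c \<longleftrightarrow>
      n > 0 \<and> c 0 > 0 \<and> n * d 1 = c 0 * d 0 + c 2 * d 2 + c 3 * d 3"
    and "d0_positive_relation d 2 n c \<longleftrightarrow>
      n > 0 \<and> c 0 > 0 \<and> n * d 2 = c 0 * d 0 + c 1 * d 1 + c 3 * d 3"
    and "d0_positive_relation d 3 n c \<longleftrightarrow>
      n > 0 \<and> c 0 > 0 \<and> n * d 3 = c 0 * d 0 + c 1 * d 1 + c 2 * d 2"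
    unfolding d0_positive_relation_def ivl by (simp_all add: add.assoc)
qed

lemma minimal_relation_le:
  assumes "d0_positive_minimal_relations d b" and "i \<in> {1..3}"
    and "d0_positive_relation d i n c"
  shows "b i i \<le> n"
proof -
  have "b i i = (LEAST n. \<exists>c. d0_positive_relation d i n c)"
    using assms(1,2) unfolding d0_positive_minimal_relations_def by blast
  then show ?thesis
    using Least_le[of "\<lambda>n. \<exists>c. d0_positive_relation d i n c" n] assms(3) by auto
qed

section \<open>Minimality of the \<open>b i i\<close> and of \<open>a00 d\<close>\<close>

context
  fixes d :: "nat \<Rightarrow> nat" and b :: "nat \<Rightarrow> nat \<Rightarrow> nat"
  assumes pos: "\<forall>i\<in>{0..3}. d i > 0"
    and rel: "d0_positive_minimal_relations d b"
begin

lemma d_pos: "d 0 > 0" "d 1 > 0" "d 2 > 0" "d 3 > 0"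
  using pos by auto

text \<open>Puts minimality in a form that takes bare coefficients. The clause \<open>n > 0\<close>
  of a \<open>d 0\<close>-positive relation comes from the right-hand side, which is at least
  \<open>l0 * d 0 > 0\<close>.\<close>

lemma b_le:
  assumes "l0 > 0"
  shows "n * d 1 = l0 * d 0 + x * d 2 + y * d 3 \<Longrightarrow> b 1 1 \<le> n"
    and "n * d 2 = l0 * d 0 + x * d 1 + y * d 3 \<Longrightarrow> b 2 2 \<le> n"
    and "n * d 3 = l0 * d 0 + x * d 1 + y * d 2 \<Longrightarrow> b 3 3 \<le> n"
proof -
  have *: "l0 * d 0 > 0" using assms d_pos by simp
  show "b 1 1 \<le> n" if "n * d 1 = l0 * d 0 + x * d 2 + y * d 3"
  proof -
    have "n > 0" using that * by (cases n) auto
    then have "d0_positive_relation d 1 n ((\<lambda>_. 0)(0 := l0, 2 := x, 3 := y))"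
      using that assms unfolding d0_positive_relation_simps by simp
    then show ?thesis using minimal_relation_le[OF rel, of 1] by simp
  qed
  show "b 2 2 \<le> n" if "n * d 2 = l0 * d 0 + x * d 1 + y * d 3"
  proof -
    have "n > 0" using that * by (cases n) auto
    then have "d0_positive_relation d 2 n ((\<lambda>_. 0)(0 := l0, 1 := x, 3 := y))"
      using that assms unfolding d0_positive_relation_simps by simp
    then show ?thesis using minimal_relation_le[OF rel, of 2] by simp
  qed
  show "b 3 3 \<le> n" if "n * d 3 = l0 * d 0 + x * d 1 + y * d 2"
  proof -
    have "n > 0" using that * by (cases n) auto
    then have "d0_positive_relation d 3 n ((\<lambda>_. 0)(0 := l0, 1 := x, 2 := y))"
      using that assms unfolding d0_positive_relation_simps by simp
    then show ?thesis using minimal_relation_le[OF rel, of 3] by simp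
  qed
qed

lemma b_relations:
  "b 1 0 > 0" "b 1 1 * d 1 = b 1 0 * d 0 + b 1 2 * d 2 + b 1 3 * d 3"
  "b 2 0 > 0" "b 2 2 * d 2 = b 2 0 * d 0 + b 2 1 * d 1 + b 2 3 * d 3"
  "b 3 0 > 0" "b 3 3 * d 3 = b 3 0 * d 0 + b 3 1 * d 1 + b 3 2 * d 2"
proof -
  have r: "d0_positive_relation d i (b i i) (b i)" if "i \<in> {1..3}" for i
    using rel that unfolding d0_positive_minimal_relations_def by blast
  have "d0_positive_relation d 1 (b 1 1) (b 1)" "d0_positive_relation d 2 (b 2 2) (b 2)"
    "d0_positive_relation d 3 (b 3 3) (b 3)"
    by (intro r; simp)+
  then show "b 1 0 > 0" "b 1 1 * d 1 = b 1 0 * d 0 + b 1 2 * d 2 + b 1 3 * d 3"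
    "b 2 0 > 0" "b 2 2 * d 2 = b 2 0 * d 0 + b 2 1 * d 1 + b 2 3 * d 3"
    "b 3 0 > 0" "b 3 3 * d 3 = b 3 0 * d 0 + b 3 1 * d 1 + b 3 2 * d 2"
    unfolding d0_positive_relation_simps by auto
qed

lemma a00_props:
  "a00 d > 0" "\<exists>a1 a2 a3. a00 d * d 0 = a1 * d 1 + a2 * d 2 + a3 * d 3"
  using LeastI_ex[OF a00_exists[of d, OF d_pos(2)]] unfolding a00_def by auto

lemma a00_le:
  assumes "n > 0" "n * d 0 = a1 * d 1 + a2 * d 2 + a3 * d 3"
  shows "a00 d \<le> n"
  unfolding a00_def using assms by (intro Least_le) blast

section \<open>Points of the deleted regions and positive multiples of \<open>d 0\<close>\<close>

text \<open>Bringing all terms except the multiple of \<open>d 0\<close> to one side of the defining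
  identity shows it; \<open>l0\<close> is \<open>a00 d\<close>, some \<open>b i 0\<close>, or the
  coefficient of \<open>d 0\<close> in the mixed identity.\<close>

lemma point_identity:
  assumes "(p1, p2, p3) \<in> points_a d \<union> points_b b \<union> points_mixed d b"
  shows "\<exists>l0::nat. l0 > 0 \<and> p1 * int (d 1) + p2 * int (d 2) + p3 * int (d 3) = int l0 * int (d 0)"
proof -
  \<comment> \<open>A common template for all families: capital letters hold the positive parts of
    the coordinates and primed letters the negative parts.\<close>
  have I: "\<exists>l0::nat. l0 > 0 \<and> x * int (d 1) + y * int (d 2) + z * int (d 3) = int l0 * int (d 0)"
    if "l0 > 0" "l0 * d 0 + x' * d 1 + y' * d 2 + z' * d 3 = X * d 1 + Y * d 2 + Z * d 3"
      "x = int X - int x'" "y = int Y - int y'" "z = int Z - int z'"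
    for l0 x' y' z' X Y Z :: nat and x y z :: int
  proof -
    have "int (l0 * d 0 + x' * d 1 + y' * d 2 + z' * d 3) = int (X * d 1 + Y * d 2 + Z * d 3)"
      using that(2) by (rule arg_cong)
    then show ?thesis
      unfolding that(3-5) using that(1) by (intro exI[of _ l0]) (simp add: algebra_simps)
  qed
  consider (a) "(p1, p2, p3) \<in> points_a d" | (b) "(p1, p2, p3) \<in> points_b b"
    | (m) "(p1, p2, p3) \<in> points_mixed d b" using assms by blast
  then show ?thesis
  proof cases
    case a
    then obtain a1 a2 a3 where "p1 = int a1" "p2 = int a2" "p3 = int a3"
      "a00 d * d 0 = a1 * d 1 + a2 * d 2 + a3 * d 3"
      unfolding points_a_def by blast
    then show ?thesis using a00_props(1) by (intro I[of "a00 d" 0 0 0 a1 a2 a3]) auto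
  next
    case b
    then consider
        "p1 = int (b 1 1)" "p2 = - int (b 1 2)" "p3 = - int (b 1 3)"
      | "p1 = - int (b 2 1)" "p2 = int (b 2 2)" "p3 = - int (b 2 3)"
      | "p1 = - int (b 3 1)" "p2 = - int (b 3 2)" "p3 = int (b 3 3)"
      unfolding points_b_def by blast
    then show ?thesis
    proof cases
      case 1
      then show ?thesis
        using b_relations(1,2) by (intro I[of "b 1 0" 0 "b 1 2" "b 1 3" "b 1 1" 0 0]) auto
    next
      case 2
      then show ?thesis
        using b_relations(3,4) by (intro I[of "b 2 0" "b 2 1" 0 "b 2 3" 0 "b 2 2" 0]) auto
    next
      case 3
      then show ?thesis
        using b_relations(5,6) by (intro I[of "b 3 0" "b 3 1" "b 3 2" 0 0 0 "b 3 3"]) auto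
    qed
  next
    case m
    then consider (m1) l0 l1 l2 l3 where "p1 = - int l1" "p2 = int l2" "p3 = int l3"
        "l0 * d 0 + l1 * d 1 = l2 * d 2 + l3 * d 3" "l0 > 0"
      | (m2) l0 l1 l2 l3 where "p1 = int l1" "p2 = - int l2" "p3 = int l3"
        "l0 * d 0 + l2 * d 2 = l1 * d 1 + l3 * d 3" "l0 > 0"
      | (m3) l0 l1 l2 l3 where "p1 = int l1" "p2 = int l2" "p3 = - int l3"
        "l0 * d 0 + l3 * d 3 = l1 * d 1 + l2 * d 2" "l0 > 0"
      unfolding points_mixed_def by blast
    then show ?thesis
    proof cases
      case m1
      then show ?thesis by (intro I[of l0 l1 0 0 0 l2 l3]) auto
    next
      case m2
      then show ?thesis by (intro I[of l0 0 l2 0 l1 0 l3]) auto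
    next
      case m3
      then show ?thesis by (intro I[of l0 0 0 l3 l1 l2 0]) auto
    qed
  qed
qed

text \<open>The point obtained avoids \<open>points_a d\<close>, so no induction on
  \<open>l0\<close> is required: a single subtraction reduces the all-positive case to this
  one.\<close>

lemma point_below_not_all_positive:
  fixes p1 p2 p3 :: int and i j k l0 :: nat
  assumes le: "p1 \<le> int i" "p2 \<le> int j" "p3 \<le> int k"
    and "l0 > 0"
    and eq: "p1 * int (d 1) + p2 * int (d 2) + p3 * int (d 3) = int l0 * int (d 0)"
    and "\<not> (p1 > 0 \<and> p2 > 0 \<and> p3 > 0)"
  shows "\<exists>(a, b, c) \<in> points_b b \<union> points_mixed d b. a \<le> int i \<and> b \<le> int j \<and> c \<le> int k"
proof -
  \<comment> \<open>Each point of \<open>points_b b\<close> has only one coordinate that can be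
    positive, so a single inequality already places it below \<open>(i, j, k)\<close>.\<close>
  have B: ?thesis if "b 1 1 \<le> i \<or> b 2 2 \<le> j \<or> b 3 3 \<le> k"
    using that by (fastforce simp: points_b_def)
  have M: ?thesis if "(p1, p2, p3) \<in> points_mixed d b"
    using that le by blast
  have nonpos: "x * int (d n) \<le> 0" if "x \<le> 0" for x n
    using that by (simp add: mult_nonpos_nonneg)
  have "int l0 * int (d 0) > 0"
    using \<open>l0 > 0\<close> d_pos by simp
  \<comment> \<open>Three nonpositive coordinates cannot give a positive multiple of
    \<open>d 0\<close>. Six sign patterns remain, with zero counted as nonpositive.\<close>
  with eq have "p1 > 0 \<or> p2 > 0 \<or> p3 > 0"
    using nonpos[of p1 1] nonpos[of p2 2] nonpos[of p3 3] by linarith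
  then consider "p1 > 0" "p2 \<le> 0" "p3 \<le> 0" | "p1 \<le> 0" "p2 > 0" "p3 \<le> 0"
    | "p1 \<le> 0" "p2 \<le> 0" "p3 > 0" | "p1 \<le> 0" "p2 > 0" "p3 > 0"
    | "p1 > 0" "p2 \<le> 0" "p3 > 0" | "p1 > 0" "p2 > 0" "p3 \<le> 0"
    using assms(6) by linarith
  then show ?thesis
  proof cases
    case 1
    then obtain n x y where p: "p1 = int n" "p2 = - int x" "p3 = - int y"
      by (metis nonpos_int_cases zero_less_imp_eq_int)
    have "int (n * d 1) = int (l0 * d 0 + x * d 2 + y * d 3)"
      using eq unfolding p by simp
    then have "b 1 1 \<le> n" using b_le(1)[OF \<open>l0 > 0\<close>] by (simp only: of_nat_eq_iff)
    then show ?thesis using B le p by simp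
  next
    case 2
    then obtain n x y where p: "p2 = int n" "p1 = - int x" "p3 = - int y"
      by (metis nonpos_int_cases zero_less_imp_eq_int)
    have "int (n * d 2) = int (l0 * d 0 + x * d 1 + y * d 3)"
      using eq unfolding p by simp
    then have "b 2 2 \<le> n" using b_le(2)[OF \<open>l0 > 0\<close>] by (simp only: of_nat_eq_iff)
    then show ?thesis using B le p by simp
  next
    case 3
    then obtain n x y where p: "p3 = int n" "p1 = - int x" "p2 = - int y"
      by (metis nonpos_int_cases zero_less_imp_eq_int)
    have "int (n * d 3) = int (l0 * d 0 + x * d 1 + y * d 2)"
      using eq unfolding p by simp
    then have "b 3 3 \<le> n" using b_le(3)[OF \<open>l0 > 0\<close>] by (simp only: of_nat_eq_iff)
    then show ?thesis using B le p by simp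
  next
    case 4
    then obtain l1 l2 l3 where p: "p1 = - int l1" "p2 = int l2" "p3 = int l3"
      by (metis nonpos_int_cases zero_less_imp_eq_int)
    have "int (l0 * d 0 + l1 * d 1) = int (l2 * d 2 + l3 * d 3)"
      using eq unfolding p by simp
    then have e: "l0 * d 0 + l1 * d 1 = l2 * d 2 + l3 * d 3" by (simp only: of_nat_eq_iff)
    show ?thesis
    \<comment> \<open>These bounds are the side conditions of \<open>points_mixed\<close>. If one
      fails, that coordinate reaches its \<open>b i i\<close>, and so does the larger
      \<open>j\<close> or \<open>k\<close>.\<close>
    proof (cases "l2 < b 2 2 \<and> l3 < b 3 3")
      case True
      then have "(p1, p2, p3) \<in> points_mixed d b"
        using e \<open>l0 > 0\<close> unfolding p points_mixed_def by blast
      then show ?thesis by (rule M)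
    next
      case False
      then show ?thesis using B le p by linarith
    qed
  next
    case 5
    then obtain l1 l2 l3 where p: "p2 = - int l2" "p1 = int l1" "p3 = int l3"
      by (metis nonpos_int_cases zero_less_imp_eq_int)
    have "int (l0 * d 0 + l2 * d 2) = int (l1 * d 1 + l3 * d 3)"
      using eq unfolding p by simp
    then have e: "l0 * d 0 + l2 * d 2 = l1 * d 1 + l3 * d 3" by (simp only: of_nat_eq_iff)
    show ?thesis
    proof (cases "l1 < b 1 1 \<and> l3 < b 3 3")
      case True
      then have "(p1, p2, p3) \<in> points_mixed d b"
        using e \<open>l0 > 0\<close> unfolding p points_mixed_def by blast
      then show ?thesis by (rule M)
    next
      case False
      then show ?thesis using B le p by linarith
    qed
  next
    case 6
    then obtain l1 l2 l3 where p: "p3 = - int l3" "p1 = int l1" "p2 = int l2"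
      by (metis nonpos_int_cases zero_less_imp_eq_int)
    have "int (l0 * d 0 + l3 * d 3) = int (l1 * d 1 + l2 * d 2)"
      using eq unfolding p by simp
    then have e: "l0 * d 0 + l3 * d 3 = l1 * d 1 + l2 * d 2" by (simp only: of_nat_eq_iff)
    show ?thesis
    proof (cases "l1 < b 1 1 \<and> l2 < b 2 2")
      case True
      then have "(p1, p2, p3) \<in> points_mixed d b"
        using e \<open>l0 > 0\<close> unfolding p points_mixed_def by blast
      then show ?thesis by (rule M)
    next
      case False
      then show ?thesis using B le p by linarith
    qed
  qed
qed

lemma point_below:
  fixes p1 p2 p3 :: int and i j k l0 :: nat
  assumes le: "p1 \<le> int i" "p2 \<le> int j" "p3 \<le> int k"
    and "l0 > 0"
    and eq: "p1 * int (d 1) + p2 * int (d 2) + p3 * int (d 3) = int l0 * int (d 0)"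
  shows "\<exists>(a, b, c) \<in> points_a d \<union> points_b b \<union> points_mixed d b.
    a \<le> int i \<and> b \<le> int j \<and> c \<le> int k"
proof (cases "p1 > 0 \<and> p2 > 0 \<and> p3 > 0")
  case False
  then show ?thesis
    using point_below_not_all_positive[OF le \<open>l0 > 0\<close> eq] by blast
next
  case True
  then obtain n1 n2 n3 where p: "p1 = int n1" "p2 = int n2" "p3 = int n3"
    by (metis zero_less_imp_eq_int)
  have "int (l0 * d 0) = int (n1 * d 1 + n2 * d 2 + n3 * d 3)"
    using eq unfolding p by simp
  then have e: "l0 * d 0 = n1 * d 1 + n2 * d 2 + n3 * d 3"
    by (simp only: of_nat_eq_iff)
  show ?thesis
  proof (cases "l0 = a00 d")
    case True
    then have "(p1, p2, p3) \<in> points_a d"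
      using e unfolding p points_a_def by blast
    then show ?thesis using le by blast
  next
    case False
    \<comment> \<open>By \<open>e\<close>, \<open>l0\<close> competes in the minimum defining
      \<open>a00 d\<close>, so \<open>l0\<close> is strictly larger and \<open>p - a\<close> still
      yields a positive multiple of \<open>d 0\<close>.\<close>
    then have gt: "l0 - a00 d > 0" using a00_le[OF \<open>l0 > 0\<close> e] by simp
    obtain a1 a2 a3 where a: "a00 d * d 0 = a1 * d 1 + a2 * d 2 + a3 * d 3"
      using a00_props(2) by blast
    then have mem: "(int a1, int a2, int a3) \<in> points_a d"
      unfolding points_a_def by blast
    show ?thesis
    proof (cases "p1 - int a1 > 0 \<and> p2 - int a2 > 0 \<and> p3 - int a3 > 0")
      case True
      then have "int a1 \<le> int i \<and> int a2 \<le> int j \<and> int a3 \<le> int k" using le by linarith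
      then show ?thesis using mem by blast
    next
      case False
      have "int (a00 d) * int (d 0) = int a1 * int (d 1) + int a2 * int (d 2) + int a3 * int (d 3)"
        using arg_cong[OF a, of int] by simp
      then have "(p1 - int a1) * int (d 1) + (p2 - int a2) * int (d 2) + (p3 - int a3) * int (d 3)
          = int (l0 - a00 d) * int (d 0)"
        using eq gt by (simp add: of_nat_diff algebra_simps)
      \<comment> \<open>Since \<open>a\<close> has nonnegative coordinates, \<open>p - a\<close>
        stays below \<open>(i, j, k)\<close>.\<close>
      from point_below_not_all_positive[OF _ _ _ gt this False, of i j k] show ?thesis
        using le by fastforce
    qed
  qed
qed

text \<open>Points \<open>p\<close> below \<open>(i, j, k)\<close> correspond to differences
  \<open>m = (i, j, k) - p\<close> with natural coordinates, which serve as coefficients of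
  \<open>d 1\<close>, \<open>d 2\<close>, \<open>d 3\<close>. \<open>Suc m0\<close> encodes a
  positive coefficient of \<open>d 0\<close>.\<close>

lemma point_below_iff:
  "(\<exists>(a, b, c) \<in> points_a d \<union> points_b b \<union> points_mixed d b.
      a \<le> int i \<and> b \<le> int j \<and> c \<le> int k) \<longleftrightarrow>
   (\<exists>m0 m1 m2 m3. i * d 1 + j * d 2 + k * d 3 = Suc m0 * d 0 + m1 * d 1 + m2 * d 2 + m3 * d 3)"
proof
  assume "\<exists>(a, b, c) \<in> points_a d \<union> points_b b \<union> points_mixed d b.
      a \<le> int i \<and> b \<le> int j \<and> c \<le> int k"
  then obtain p1 p2 p3 where mem: "(p1, p2, p3) \<in> points_a d \<union> points_b b \<union> points_mixed d b"
    and le: "p1 \<le> int i" "p2 \<le> int j" "p3 \<le> int k" by blast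
  obtain l0 where l0: "l0 > 0"
    "p1 * int (d 1) + p2 * int (d 2) + p3 * int (d 3) = int l0 * int (d 0)"
    using point_identity[OF mem] by blast
  obtain m0 where m0: "l0 = Suc m0" using l0(1) gr0_implies_Suc by blast
  obtain m1 m2 m3 where m: "int i = p1 + int m1" "int j = p2 + int m2" "int k = p3 + int m3"
    using le by (metis zle_iff_zadd)
  have "int (i * d 1 + j * d 2 + k * d 3) = int (Suc m0 * d 0 + m1 * d 1 + m2 * d 2 + m3 * d 3)"
    using l0(2) unfolding of_nat_add of_nat_mult m m0 by (simp add: algebra_simps)
  then show "\<exists>m0 m1 m2 m3.
      i * d 1 + j * d 2 + k * d 3 = Suc m0 * d 0 + m1 * d 1 + m2 * d 2 + m3 * d 3"
    unfolding of_nat_eq_iff by blast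
next
  assume "\<exists>m0 m1 m2 m3.
      i * d 1 + j * d 2 + k * d 3 = Suc m0 * d 0 + m1 * d 1 + m2 * d 2 + m3 * d 3"
  then obtain m0 m1 m2 m3 where
    m: "i * d 1 + j * d 2 + k * d 3 = Suc m0 * d 0 + m1 * d 1 + m2 * d 2 + m3 * d 3" by blast
  have "(int i - int m1) * int (d 1) + (int j - int m2) * int (d 2) + (int k - int m3) * int (d 3)
      = int (Suc m0) * int (d 0)"
    using arg_cong[OF m, of int] by (simp add: algebra_simps)
  then show "\<exists>(a, b, c) \<in> points_a d \<union> points_b b \<union> points_mixed d b.
      a \<le> int i \<and> b \<le> int j \<and> c \<le> int k"
    by (intro point_below[of "int i - int m1" i "int j - int m2" j "int k - int m3" k "Suc m0"])
      auto
qed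

end

section \<open>From deleted cubes to the Apery set\<close>

lemma cube_in_removed_iff:
  "(cube i j k, s) \<in> removed (a, b, c) \<longleftrightarrow> a \<le> int i \<and> b \<le> int j \<and> c \<le> int k"
  by (auto simp: removed_def cube_inject)

theorem theorem2p2:
  fixes S :: "nat set" and d :: "nat \<Rightarrow> nat" and b :: "nat \<Rightarrow> nat \<Rightarrow> nat"
  assumes "\<forall>i\<in>{0..3}. d i > 0"
    and "inj_on d {0..3}"
    and "Gcd (d ` {0..3}) = 1"
    and "minimal_generators (d ` {0..3}) S"
    and "d0_positive_minimal_relations d b"
  shows "delete_regions (points_a d \<union> points_b b \<union> points_mixed d b) (initial_cubes d) =
           {(Q, s). (Q, s) \<in> initial_cubes d \<and> s \<in> Apery S (d 0)}"
proof -
  let ?X = "points_a d \<union> points_b b \<union> points_mixed d b"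
  have S: "s \<in> S \<longleftrightarrow> (\<exists>m0 m1 m2 m3. s = m0 * d 0 + m1 * d 1 + m2 * d 2 + m3 * d 3)" for s
    using assms(4) nonneg_combs_generators[OF assms(2)] by (simp add: minimal_generators_def)
  have key: "(\<exists>P\<in>?X. (cube i j k, s) \<in> removed P) \<longleftrightarrow> s \<notin> Apery S (d 0)"
    if s: "s = i * d 1 + j * d 2 + k * d 3" for i j k s
  proof -
    have "(\<exists>P\<in>?X. (cube i j k, s) \<in> removed P) \<longleftrightarrow>
        (\<exists>(a, b, c) \<in> ?X. a \<le> int i \<and> b \<le> int j \<and> c \<le> int k)"
      by (intro bex_cong) (auto simp: cube_in_removed_iff)
    also have "\<dots> \<longleftrightarrow> (\<exists>m0 m1 m2 m3. s = Suc m0 * d 0 + m1 * d 1 + m2 * d 2 + m3 * d 3)"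
      unfolding s by (rule point_below_iff[OF assms(1,5)])
    \<comment> \<open>Splitting one copy of \<open>d 0\<close> off \<open>Suc m0\<close> leaves an
      arbitrary element of \<open>S\<close>.\<close>
    also have "\<dots> \<longleftrightarrow> (\<exists>m0 m1 m2 m3. s = m0 * d 0 + m1 * d 1 + m2 * d 2 + m3 * d 3 + d 0)"
      by (simp add: ac_simps)
    also have "\<dots> \<longleftrightarrow> (\<exists>t\<in>S. s = t + d 0)"
      unfolding Bex_def S by blast
    also have "\<dots> \<longleftrightarrow> int s - int (d 0) \<in> int ` S"
      by (auto simp: image_iff algebra_simps simp flip: of_nat_add intro!: bexI)
    also have "\<dots> \<longleftrightarrow> s \<notin> Apery S (d 0)"
    proof -
      \<comment> \<open>Every label lies in \<open>S\<close>, so it can leave the Apery set only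
        because \<open>s - d 0\<close> lies in \<open>S\<close>.\<close>
      have "s = 0 * d 0 + i * d 1 + j * d 2 + k * d 3" by (simp add: s)
      then have "s \<in> S" unfolding S by blast
      then show ?thesis by (simp add: Apery_def)
    qed
    finally show ?thesis .
  qed
  show ?thesis
  proof (intro set_eqI iffI)
    fix x assume "x \<in> delete_regions ?X (initial_cubes d)"
    then show "x \<in> {(Q, s). (Q, s) \<in> initial_cubes d \<and> s \<in> Apery S (d 0)}"
      using key unfolding delete_regions_def initial_cubes_def by blast
  next
    fix x assume "x \<in> {(Q, s). (Q, s) \<in> initial_cubes d \<and> s \<in> Apery S (d 0)}"
    then show "x \<in> delete_regions ?X (initial_cubes d)"
      using key unfolding delete_regions_def initial_cubes_def by blast
  qed
qed

end
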